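(* For each $n\in N$ let $\mathcal{D}_n$ be a coherent set of desirable gambles on $\mathcal{X}_n$. Then $\otimes_{n\in N}\mathcal{D}_n$ is the smallest (with respect to inclusion) coherent set of desirable gambles on $\mathcal{X}_N$ that is an independent product of the coherent sets of desirable gambles $\mathcal{D}_n$, $n\in N$.
   Context: Let $N$ be a finite non-empty index set, and for each $n\in N$ let $\mathcal{X}_n$ be a finite non-empty set. For $R\subseteq N$ let $\mathcal{X}_R:=\prod_{r\in R}\mathcal{X}_r$, with $\mathcal{X}_\emptyset$ a one-point set. Subsets of $N$ are allowed to be empty, and an index $n$ is identified with $\{n\}$. For a finite non-empty set $\mathcal{Z}$, a gamble on $\mathcal{Z}$ is a function $\mathcal{Z}\to\mathbb{R}$; $\mathcal{G}(\mathcal{Z})$ is the linear space of all gambles on $\mathcal{Z}$. Write $f\geq g$ for pointwise inequality and $f>g$ if $f\geq g$ and $f\neq g$; $\mathcal{G}(\mathcal{Z})_{>0}:=\{f\in\mathcal{G}(\mathcal{Z}):f>0\}$. For $\mathcal{A}\subseteq\mathcal{G}(\mathcal{Z})$, $\mathrm{posi}(\mathcal{A}):=\{\sum_{k=1}^{m}\lambda_kf_k : m\geq 1,\ f_k\in\mathcal{A},\ \lambda_k>0\}$. A set of desirable gambles $\mathcal{D}\subseteq\mathcal{G}(\mathcal{Z})$ is coherent if (D1) $0\notin\mathcal{D}$; (D2) $\mathcal{G}(\mathcal{Z})_{>0}\subseteq\mathcal{D}$; (D3) $\mathrm{posi}(\mathcal{D})=\mathcal{D}$. For $R\subseteq S\subseteq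 N$, a gamble $f$ on $\mathcal{X}_R$ is identified with its cylindrical extension $x_S\mapsto f(x_R)$ on $\mathcal{X}_S$; $\mathbb{I}_{\{x_R\}}$ denotes the indicator of $x_R\in\mathcal{X}_R$ (identified in the same way with a gamble on $\mathcal{X}_S$). Marginalisation: for $O\subseteq S\subseteq N$ and $\mathcal{D}\subseteq\mathcal{G}(\mathcal{X}_S)$, $\mathrm{marg}_O(\mathcal{D}):=\mathcal{D}\cap\mathcal{G}(\mathcal{X}_O)$. Conditioning: for $I\subseteq S\subseteq N$, $\mathcal{D}\subseteq\mathcal{G}(\mathcal{X}_S)$ and $x_I\in\mathcal{X}_I$, $\mathcal{D}\rfloor x_I:=\{g\in\mathcal{G}(\mathcal{X}_{S\setminus I}):\mathbb{I}_{\{x_I\}}g\in\mathcal{D}\}$. A coherent set $\mathcal{D}_N$ of desirable gambles on $\mathcal{X}_N$ is independent if $\mathrm{marg}_O(\mathcal{D}_N\rfloor x_I)=\mathrm{marg}_O(\mathcal{D}_N)$ for all disjoint subsets $I,O$ of $N$ and all $x_I\in\mathcal{X}_I$. An independent product of the $\mathcal{D}_n$, $n\in N$, is an independent coherent set $\mathcal{D}_N$ of desirable gambles on $\mathcal{X}_N$ with $\mathrm{marg}_{\{n\}}(\mathcal{D}_N)=\mathcal{D}_n$ for all $n\in N$. For coherent $\mathcal{D}_n\subseteq\mathcal{G}(\mathcal{X}_n)$, $n\in N$, define $$\mathcal{A}^{\mathrm{irr}}_{N\setminus\{n\}\to\{n\}}:=\mathrm{posi}\left(\{\mathbb{I}_{\{x_{N\setminus\{n\}}\}}g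 : g\in\mathcal{D}_n,\ x_{N\setminus\{n\}}\in\mathcal{X}_{N\setminus\{n\}}\}\right),\qquad \otimes_{n\in N}\mathcal{D}_n:=\mathrm{posi}\Big(\mathcal{G}(\mathcal{X}_N)_{>0}\cup\bigcup_{n\in N}\mathcal{A}^{\mathrm{irr}}_{N\setminus\{n\}\to\{n\}}\Big).$$ *)

theory Defs
  imports Complex_Main "HOL-Library.FuncSet" "HOL-Library.Indicator_Function"
begin

(* A gamble on Z is represented by the unique function on the ambient type that agrees with it
   on Z and is 0 elsewhere. These functions are closed under pointwise linear combinations,
   which functions in extensional Z are not. *)
definition gambles :: "'z set \<Rightarrow> ('z \<Rightarrow> real) set" where
  "gambles Z = {f. \<forall>z. z \<notin> Z \<longrightarrow> f z = 0}"

definition pos_gambles :: "'z set \<Rightarrow> ('z \<Rightarrow> real) set" where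
  "pos_gambles Z = {f \<in> gambles Z. (\<forall>z\<in>Z. f z \<ge> 0) \<and> f \<noteq> (\<lambda>_. 0)}"

definition posi :: "('z \<Rightarrow> real) set \<Rightarrow> ('z \<Rightarrow> real) set" where
  "posi A = {(\<lambda>z. \<Sum>k=1..m. c k * f k z) | m c f.
     m \<ge> (1::nat) \<and> (\<forall>k\<in>{1..m}. f k \<in> A \<and> c k > (0::real))}"

definition coherent :: "'z set \<Rightarrow> ('z \<Rightarrow> real) set \<Rightarrow> bool" where
  "coherent Z D \<longleftrightarrow>
     D \<subseteq> gambles Z \<and> (\<lambda>_. 0) \<notin> D \<and> pos_gambles Z \<subseteq> D \<and> posi D = D"

(* The product of the sets X r over r in R is PiE R X. In particular PiE {} X has exactly one
   element, and the projection of x in PiE S X to R, a subset of S, is restrict x R. *)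

definition cyl_ext ::
  "('i \<Rightarrow> 'a set) \<Rightarrow> 'i set \<Rightarrow> 'i set \<Rightarrow> (('i \<Rightarrow> 'a) \<Rightarrow> real) \<Rightarrow> ('i \<Rightarrow> 'a) \<Rightarrow> real" where
  "cyl_ext X S R f = (\<lambda>x. if x \<in> PiE S X then f (restrict x R) else 0)"

(* The identification of an index n with {n}: a gamble on X n, viewed as one on PiE {n} X. *)
definition singleton_gamble ::
  "('i \<Rightarrow> 'a set) \<Rightarrow> 'i \<Rightarrow> ('a \<Rightarrow> real) \<Rightarrow> ('i \<Rightarrow> 'a) \<Rightarrow> real" where
  "singleton_gamble X n g = (\<lambda>x. if x \<in> PiE {n} X then g (x n) else 0)"

(* In marg and cond, S is the index set of the product on which D is a set of gambles. *)

definition marg ::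
  "('i \<Rightarrow> 'a set) \<Rightarrow> 'i set \<Rightarrow> 'i set \<Rightarrow> (('i \<Rightarrow> 'a) \<Rightarrow> real) set \<Rightarrow> (('i \<Rightarrow> 'a) \<Rightarrow> real) set" where
  "marg X S R D = {f \<in> gambles (PiE R X). cyl_ext X S R f \<in> D}"

definition cond ::
  "('i \<Rightarrow> 'a set) \<Rightarrow> 'i set \<Rightarrow> 'i set \<Rightarrow> (('i \<Rightarrow> 'a) \<Rightarrow> real) set \<Rightarrow> ('i \<Rightarrow> 'a) \<Rightarrow>
     (('i \<Rightarrow> 'a) \<Rightarrow> real) set" where
  "cond X S I D xI = {g \<in> gambles (PiE (S - I) X).
     (\<lambda>x. cyl_ext X S I (indicator {xI}) x * cyl_ext X S (S - I) g x) \<in> D}"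

definition independent ::
  "('i \<Rightarrow> 'a set) \<Rightarrow> 'i set \<Rightarrow> (('i \<Rightarrow> 'a) \<Rightarrow> real) set \<Rightarrow> bool" where
  "independent X N D \<longleftrightarrow> coherent (PiE N X) D \<and>
     (\<forall>I R. I \<subseteq> N \<longrightarrow> R \<subseteq> N \<longrightarrow> I \<inter> R = {} \<longrightarrow>
        (\<forall>xI \<in> PiE I X. marg X (N - I) R (cond X N I D xI) = marg X N R D))"

definition independent_product ::
  "('i \<Rightarrow> 'a set) \<Rightarrow> 'i set \<Rightarrow> ('i \<Rightarrow> ('a \<Rightarrow> real) set) \<Rightarrow> (('i \<Rightarrow> 'a) \<Rightarrow> real) set \<Rightarrow> bool" where
  "independent_product X N D DN \<longleftrightarrow> independent X N DN \<and>
     (\<forall>n\<in>N. marg X N {n} DN = singleton_gamble X n ` D n)"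

definition A_irr ::
  "('i \<Rightarrow> 'a set) \<Rightarrow> 'i set \<Rightarrow> 'i \<Rightarrow> ('a \<Rightarrow> real) set \<Rightarrow> (('i \<Rightarrow> 'a) \<Rightarrow> real) set" where
  "A_irr X N n Dn = posi {(\<lambda>x. cyl_ext X N (N - {n}) (indicator {y}) x *
        cyl_ext X N {n} (singleton_gamble X n g) x) | y g. g \<in> Dn \<and> y \<in> PiE (N - {n}) X}"

definition indep_nat_ext ::
  "('i \<Rightarrow> 'a set) \<Rightarrow> 'i set \<Rightarrow> ('i \<Rightarrow> ('a \<Rightarrow> real) set) \<Rightarrow> (('i \<Rightarrow> 'a) \<Rightarrow> real) set" where
  "indep_nat_ext X N D = posi (pos_gambles (PiE N X) \<union> (\<Union>n\<in>N. A_irr X N n (D n)))"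

end

theory Submission
  imports Defs
begin

text \<open>Up to the zero gamble, the independent natural extension is the cone generated by the
  nonnegative gambles and, for each \<^term>\<open>n\<close>, the gambles all of whose sections in the
  coordinate \<^term>\<open>n\<close> are zero or desirable. Such a gamble has finitely many sections, so a
  theorem of the alternative gives strictly positive weights on \<^term>\<open>X n\<close> under which every
  nonzero section has a positive mean. Averaging the coordinate \<^term>\<open>n\<close> out with these weights
  turns the \<^term>\<open>n\<close>-th summand into a nonnegative gamble and keeps the other summands in their
  cones. Averaging coordinates out one by one shows that the cone is pointed, whence coherence, and
  that a gamble in it that does not depend on some coordinates is already a sum without the
  corresponding summands, whence independence and the marginals. Minimality is read off
  the independence condition with \<open>I = N - {n}\<close> and \<open>O = {n}\<close>.\<close>

section \<open>A theorem of the alternative\<close>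

text \<open>Serves to choose the weight of an eliminated coordinate: \<open>U\<close> collects its
  strict lower bounds and \<open>V\<close> its strict upper bounds, and either may be empty.\<close>

lemma finite_sets_separated:
  fixes U V :: "real set"
  assumes "finite U" "finite V" "\<And>u v. u \<in> U \<Longrightarrow> v \<in> V \<Longrightarrow> u < v"
  shows "\<exists>t. (\<forall>u\<in>U. u < t) \<and> (\<forall>v\<in>V. t < v)"
proof (cases "U = {}")
  case True
  have "\<exists>t. \<forall>v\<in>V. t < v"
    using assms(2)
  proof (cases "V = {}")
    case False
    then have "\<forall>v\<in>V. Min V - 1 < v"
      using assms(2) by (meson Min_le diff_less_eq less_add_one less_le_trans not_le)
    then show ?thesis by blast
  qed auto
  with True show ?thesis by simp
next
  case False
  have U: "Max U \<in> U" "\<And>u. u \<in> U \<Longrightarrow> u \<le> Max U"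
    using assms(1) False by auto
  show ?thesis
  proof (cases "V = {}")
    case True
    then show ?thesis
      using U by (intro exI[of _ "Max U + 1"]) (force dest: U(2))
  next
    case False
    have V: "Min V \<in> V" "\<And>v. v \<in> V \<Longrightarrow> Min V \<le> v"
      using assms(2) False by auto
    obtain t where "Max U < t" "t < Min V"
      using dense[OF assms(3)[OF U(1) V(1)]] by blast
    then show ?thesis
      using U V by (meson le_less_trans less_le_trans)
  qed
qed

text \<open>Fourier--Motzkin elimination: the coordinate \<^term>\<open>x\<close> is removed by restricting the cone to
  the functions that vanish at \<^term>\<open>x\<close>.\<close>

lemma cone_positive_functional:
  fixes C :: "('z \<Rightarrow> real) set"
  assumes "finite Z" "finite A" "A \<subseteq> C"
    and "\<And>f g. f \<in> C \<Longrightarrow> g \<in> C \<Longrightarrow> (\<lambda>z. f z + g z) \<in> C"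
    and "\<And>f c. f \<in> C \<Longrightarrow> c > 0 \<Longrightarrow> (\<lambda>z. c * f z) \<in> C"
    and "\<And>f. f \<in> C \<Longrightarrow> \<exists>z\<in>Z. f z \<noteq> 0"
  shows "\<exists>p. \<forall>a\<in>A. (\<Sum>z\<in>Z. p z * a z) > 0"
  using assms
proof (induction Z arbitrary: C A rule: finite_induct)
  case empty
  then show ?case by blast
next
  case (insert x Z)
  define P where "P = {a \<in> A. a x > 0}"
  define Q where "Q = {a \<in> A. a x < 0}"
  \<comment> \<open>The positive combination of \<open>a\<close> in \<open>P\<close> and
    \<open>b\<close> in \<open>Q\<close> in which the values at \<open>x\<close> cancel.\<close>
  define comb :: "('z \<Rightarrow> real) \<times> ('z \<Rightarrow> real) \<Rightarrow> 'z \<Rightarrow> real"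
    where "comb = (\<lambda>(a, b) z. (- b x) * a z + a x * b z)"
  define A' where "A' = {a \<in> A. a x = 0} \<union> comb ` (P \<times> Q)"
  define C' where "C' = {f \<in> C. f x = 0}"
  have comb: "comb (a, b) \<in> C'" if "a \<in> P" "b \<in> Q" for a b
  proof -
    have "a \<in> C" "b \<in> C" "a x > 0" "- b x > 0"
      using that insert.prems(2) by (auto simp: P_def Q_def)
    then show ?thesis
      using insert.prems(3)[OF insert.prems(4) insert.prems(4), of a "- b x" b "a x"]
      by (simp add: C'_def comb_def)
  qed
  have "\<exists>p. \<forall>a\<in>A'. (\<Sum>z\<in>Z. p z * a z) > 0"
  proof (rule insert.IH)
    show "finite A'"
      using insert.prems(1) by (simp add: A'_def P_def Q_def)
    show "A' \<subseteq> C'"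
      using insert.prems(2) comb by (auto simp: A'_def C'_def)
    show "\<exists>z\<in>Z. f z \<noteq> 0" if "f \<in> C'" for f
      using that insert.prems(5)[of f] by (auto simp: C'_def)
  qed (auto simp: C'_def insert.prems)
  then obtain p where p: "\<And>a. a \<in> A' \<Longrightarrow> (\<Sum>z\<in>Z. p z * a z) > 0" by blast
  define L where "L a = (\<Sum>z\<in>Z. p z * a z)" for a
  have L_comb: "L (comb (a, b)) = (- b x) * L a + a x * L b" for a b
    by (simp add: L_def comb_def sum_distrib_left flip: sum.distrib)
       (auto intro!: sum.cong simp: algebra_simps)
  \<comment> \<open>The weight \<open>t\<close> of \<open>x\<close> has to satisfy
    \<open>L a + t * a x > 0\<close> for all \<open>a\<close> in \<open>A\<close>: a lower bound for
    \<open>a\<close> in \<open>P\<close>, an upper bound for \<open>a\<close> in \<open>Q\<close>.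
    Positivity of \<open>L\<close> on the combinations in \<open>A'\<close> puts every lower bound
    below every upper bound.\<close>
  have "\<exists>t. (\<forall>u\<in>(\<lambda>a. - L a / a x) ` P. u < t) \<and> (\<forall>v\<in>(\<lambda>b. - L b / b x) ` Q. t < v)"
  proof (rule finite_sets_separated)
    show "u < v" if "u \<in> (\<lambda>a. - L a / a x) ` P" "v \<in> (\<lambda>b. - L b / b x) ` Q" for u v
    proof -
      from that obtain a b where ab: "a \<in> P" "b \<in> Q" "u = - L a / a x" "v = - L b / b x"
        by blast
      then have "0 < (- b x) * L a + a x * L b"
        using p[of "comb (a, b)"] L_comb by (auto simp: A'_def L_def)
      moreover have "a x > 0" "b x < 0"
        using ab by (auto simp: P_def Q_def)
      ultimately show ?thesis
        unfolding ab by (simp add: field_simps)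
    qed
  qed (use insert.prems(1) in \<open>auto simp: P_def Q_def\<close>)
  then obtain t where "\<forall>u\<in>(\<lambda>a. - L a / a x) ` P. u < t" "\<forall>v\<in>(\<lambda>b. - L b / b x) ` Q. t < v"
    by (elim exE conjE)
  then have t: "\<And>a. a \<in> P \<Longrightarrow> - L a / a x < t" "\<And>b. b \<in> Q \<Longrightarrow> t < - L b / b x"
    by simp_all
  have "(\<Sum>z\<in>insert x Z. (p(x := t)) z * a z) > 0" if "a \<in> A" for a
  proof -
    have "(\<Sum>z\<in>insert x Z. (p(x := t)) z * a z) = t * a x + L a"
      using insert.hyps by (auto simp: L_def intro!: sum.cong)
    moreover from that consider "a \<in> P" | "a \<in> Q" | "a x = 0"
      unfolding P_def Q_def by fastforce
    then have "t * a x + L a > 0"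
    proof cases
      case 1
      then show ?thesis using t(1)[OF 1] by (simp add: P_def field_simps)
    next
      case 2
      then show ?thesis using t(2)[OF 2] by (simp add: Q_def field_simps)
    next
      case 3
      then show ?thesis using p[of a] that by (simp add: A'_def L_def)
    qed
    ultimately show ?thesis by simp
  qed
  then show ?case by blast
qed

section \<open>Positive hulls\<close>

lemma subset_posi: "A \<subseteq> posi A"
proof
  fix f assume "f \<in> A"
  then show "f \<in> posi A"
    unfolding posi_def
    by (intro CollectI exI[of _ 1] exI[of _ "\<lambda>_. 1"] exI[of _ "\<lambda>_. f"]) auto
qed

lemma posi_scale:
  assumes "f \<in> posi A" "c > 0"
  shows "(\<lambda>z. c * f z) \<in> posi A"
proof -
  obtain m d g where "m \<ge> (1::nat)" "\<forall>k\<in>{1..m}. g k \<in> A \<and> d k > 0" "f = (\<lambda>z. \<Sum>k=1..m. d k * g k z)"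
    using assms(1) unfolding posi_def by blast
  then show ?thesis
    using assms(2) unfolding posi_def
    by (intro CollectI exI[of _ m] exI[of _ "\<lambda>k. c * d k"] exI[of _ g])
       (auto simp: sum_distrib_left mult.assoc)
qed

lemma posi_add:
  assumes "f \<in> posi A" "g \<in> posi A"
  shows "(\<lambda>z. f z + g z) \<in> posi A"
proof -
  obtain m c u where m: "m \<ge> (1::nat)" "\<forall>k\<in>{1..m}. u k \<in> A \<and> c k > 0"
    and f: "f = (\<lambda>z. \<Sum>k=1..m. c k * u k z)"
    using assms(1) unfolding posi_def by blast
  obtain n d v where n: "n \<ge> (1::nat)" "\<forall>k\<in>{1..n}. v k \<in> A \<and> d k > 0"
    and g: "g = (\<lambda>z. \<Sum>k=1..n. d k * v k z)"
    using assms(2) unfolding posi_def by blast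
  \<comment> \<open>Concatenation of the two sums: indices above \<open>m\<close> read the second
    one, shifted by \<open>m\<close>.\<close>
  define e where "e k = (if k \<le> m then c k else d (k - m))" for k
  define w where "w k = (if k \<le> m then u k else v (k - m))" for k
  have "(\<Sum>k=1..m + n. e k * w k z) = f z + g z" for z
  proof -
    have "(\<Sum>k=1..m + n. e k * w k z)
        = (\<Sum>k=1..m. e k * w k z) + (\<Sum>k=Suc m..m + n. e k * w k z)"
      by (subst sum.ub_add_nat) auto
    also have "(\<Sum>k=Suc m..m + n. e k * w k z) = (\<Sum>k=1..n. e (k + m) * w (k + m) z)"
      using sum.shift_bounds_cl_nat_ivl[of "\<lambda>k. e k * w k z" 1 m n]
      by (simp add: add.commute)
    finally show ?thesis by (simp add: f g e_def w_def)
  qed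
  moreover have "\<forall>k\<in>{1..m + n}. w k \<in> A \<and> e k > 0"
  proof
    fix k assume "k \<in> {1..m + n}"
    then have "k \<le> m \<and> k \<in> {1..m} \<or> \<not> k \<le> m \<and> k - m \<in> {1..n}" by auto
    then show "w k \<in> A \<and> e k > 0"
      using m(2) n(2) by (auto simp only: e_def w_def if_True if_False)
  qed
  ultimately show ?thesis
    using m(1) unfolding posi_def
    by (intro CollectI exI[of _ "m + n"] exI[of _ e] exI[of _ w]) auto
qed

text \<open>Induction on the number of summands. It starts at one because \<open>posi\<close> has no
  empty sums, so the lemma also applies to sets \<open>B\<close> without the zero gamble.\<close>

lemma posi_least:
  assumes "A \<subseteq> B"
    and "\<And>f g. f \<in> B \<Longrightarrow> g \<in> B \<Longrightarrow> (\<lambda>z. f z + g z) \<in> B"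
    and "\<And>f c. f \<in> B \<Longrightarrow> c > 0 \<Longrightarrow> (\<lambda>z. c * f z) \<in> B"
  shows "posi A \<subseteq> B"
proof
  fix f assume "f \<in> posi A"
  then obtain m c u where m: "m \<ge> (1::nat)" "\<forall>k\<in>{1..m}. u k \<in> A \<and> c k > 0"
    and f: "f = (\<lambda>z. \<Sum>k=1..m. c k * u k z)"
    unfolding posi_def by blast
  have "(\<lambda>z. \<Sum>k=1..m. c k * u k z) \<in> B"
    using m
  proof (induction m rule: dec_induct)
    case base
    then show ?case using assms(1,3) by auto
  next
    case (step j)
    have "(\<lambda>z. (\<Sum>k=1..j. c k * u k z) + c (Suc j) * u (Suc j) z) \<in> B"
      using step assms(1) by (intro assms(2,3)) auto
    then show ?case by simp
  qed
  then show "f \<in> B" by (simp add: f)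
qed

lemma posi_eq_self_iff:
  "posi A = A \<longleftrightarrow>
    (\<forall>f\<in>A. \<forall>g\<in>A. (\<lambda>z. f z + g z) \<in> A) \<and> (\<forall>f\<in>A. \<forall>c>0. (\<lambda>z. c * f z) \<in> A)"
proof
  assume "posi A = A"
  then show "(\<forall>f\<in>A. \<forall>g\<in>A. (\<lambda>z. f z + g z) \<in> A) \<and> (\<forall>f\<in>A. \<forall>c>0. (\<lambda>z. c * f z) \<in> A)"
    using posi_add[of _ A] posi_scale[of _ A] by simp
next
  assume "(\<forall>f\<in>A. \<forall>g\<in>A. (\<lambda>z. f z + g z) \<in> A) \<and> (\<forall>f\<in>A. \<forall>c>0. (\<lambda>z. c * f z) \<in> A)"
  then show "posi A = A"
    by (intro antisym posi_least subset_posi) auto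
qed

section \<open>Closure properties of coherent sets\<close>

lemma coherent_nonzero: "coherent Z D \<Longrightarrow> f \<in> D \<Longrightarrow> f \<noteq> (\<lambda>_. 0)"
  by (auto simp: coherent_def)

lemma coherent_gambles: "coherent Z D \<Longrightarrow> f \<in> D \<Longrightarrow> z \<notin> Z \<Longrightarrow> f z = 0"
  by (auto simp: coherent_def gambles_def)

lemma coherent_add: "coherent Z D \<Longrightarrow> f \<in> D \<Longrightarrow> g \<in> D \<Longrightarrow> (\<lambda>z. f z + g z) \<in> D"
  by (auto simp: coherent_def posi_eq_self_iff)

lemma coherent_scale: "coherent Z D \<Longrightarrow> f \<in> D \<Longrightarrow> c > 0 \<Longrightarrow> (\<lambda>z. c * f z) \<in> D"
  by (auto simp: coherent_def posi_eq_self_iff)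

lemma coherent_pos: "coherent Z D \<Longrightarrow> f \<in> pos_gambles Z \<Longrightarrow> f \<in> D"
  by (auto simp: coherent_def)

text \<open>The indicators of the points of \<open>Z\<close> are desirable and can be added to the
  finite family; a positive mean of such an indicator is positivity of the weight of its point. The
  alternative applies because a desirable gamble is nonzero and vanishes outside
  \<open>Z\<close>.\<close>

lemma coherent_positive_functional:
  assumes "coherent Z D" "finite Z" "finite A" "A \<subseteq> D"
  shows "\<exists>p. (\<forall>z\<in>Z. p z > 0) \<and> (\<forall>a\<in>A. (\<Sum>z\<in>Z. p z * a z) > 0)"
proof -
  define \<delta> :: "'a \<Rightarrow> 'a \<Rightarrow> real" where "\<delta> z = (\<lambda>y. if y = z then 1 else 0)" for z
  have "\<delta> z \<in> D" if "z \<in> Z" for z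
    using that by (intro coherent_pos[OF assms(1)])
      (auto simp: pos_gambles_def gambles_def \<delta>_def fun_eq_iff)
  then have "\<exists>p. \<forall>a\<in>A \<union> \<delta> ` Z. (\<Sum>z\<in>Z. p z * a z) > 0"
  proof (intro cone_positive_functional[where C = D])
    show "\<exists>z\<in>Z. f z \<noteq> 0" if "f \<in> D" for f
      using coherent_nonzero[OF assms(1) that] coherent_gambles[OF assms(1) that] by blast
  qed (use assms coherent_add[OF assms(1)] coherent_scale[OF assms(1)] in auto)
  then obtain p where p: "\<forall>a\<in>A \<union> \<delta> ` Z. (\<Sum>z\<in>Z. p z * a z) > 0" by blast
  moreover have "(\<Sum>y\<in>Z. p y * \<delta> z y) = p z" if "z \<in> Z" for z
    using that assms(2) by (simp add: \<delta>_def if_distrib cong: if_cong)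
  ultimately show ?thesis by (intro exI[of _ p]) force
qed

section \<open>Sums of gambles with desirable sections\<close>

locale coherent_models =
  fixes N :: "'i set" and X :: "'i \<Rightarrow> 'a set" and D :: "'i \<Rightarrow> ('a \<Rightarrow> real) set"
  assumes finite_N: "finite N"
    and finite_X: "\<And>n. n \<in> N \<Longrightarrow> finite (X n)"
    and nonempty_X: "\<And>n. n \<in> N \<Longrightarrow> X n \<noteq> {}"
    and coherent_D: "\<And>n. n \<in> N \<Longrightarrow> coherent (X n) (D n)"
begin

abbreviation \<Omega> :: "('i \<Rightarrow> 'a) set" where
  "\<Omega> \<equiv> PiE N X"

text \<open>Unlike \<open>pos_gambles\<close>, this cone contains zero, so that summands in a
  decomposition may be trivial.\<close>

definition nonneg_gambles :: "(('i \<Rightarrow> 'a) \<Rightarrow> real) set" where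
  "nonneg_gambles = {f \<in> gambles \<Omega>. \<forall>z. f z \<ge> 0}"

text \<open>Zero sections are allowed because a gamble built from \<open>D n\<close> may vanish on
  some lines in direction \<open>n\<close>. For \<open>n\<close> in \<open>N\<close> a section
  vanishes outside \<open>X n\<close>, as the members of \<open>D n\<close> do, so it can be taken
  over the whole type.\<close>

definition sectional :: "'i \<Rightarrow> (('i \<Rightarrow> 'a) \<Rightarrow> real) set" where
  "sectional n = {f \<in> gambles \<Omega>. \<forall>z\<in>\<Omega>. (\<lambda>a. f (z(n := a))) \<in> insert (\<lambda>_. 0) (D n)}"

text \<open>With the set \<open>M\<close> of admissible directions as a parameter, induction over
  coordinates is possible. For \<open>M\<close> inside \<open>N\<close> both kinds of generators are
  closed under nonnegative multiples, so scaling follows without a rule of its own.\<close>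

inductive_set sum_cone :: "'i set \<Rightarrow> (('i \<Rightarrow> 'a) \<Rightarrow> real) set" for M where
  nonneg: "f \<in> nonneg_gambles \<Longrightarrow> f \<in> sum_cone M"
| sectional: "n \<in> M \<Longrightarrow> f \<in> sectional n \<Longrightarrow> f \<in> sum_cone M"
| add: "f \<in> sum_cone M \<Longrightarrow> g \<in> sum_cone M \<Longrightarrow> (\<lambda>z. f z + g z) \<in> sum_cone M"

text \<open>The weights are not normalised, since only signs matter. The result stays a gamble on
  \<open>\<Omega>\<close>, so that it can lie in the same cones as \<open>f\<close>.\<close>

definition average :: "'i \<Rightarrow> ('a \<Rightarrow> real) \<Rightarrow> (('i \<Rightarrow> 'a) \<Rightarrow> real) \<Rightarrow> ('i \<Rightarrow> 'a) \<Rightarrow> real" where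
  "average i p f = (\<lambda>z. if z \<in> \<Omega> then \<Sum>a\<in>X i. p a * f (z(i := a)) else 0)"

lemma update_in_\<Omega>: "z \<in> \<Omega> \<Longrightarrow> i \<in> N \<Longrightarrow> a \<in> X i \<Longrightarrow> z(i := a) \<in> \<Omega>"
  by (auto simp: PiE_iff extensional_def)

lemma update_notin_\<Omega>: "i \<in> N \<Longrightarrow> a \<notin> X i \<Longrightarrow> z(i := a) \<notin> \<Omega>"
  by (auto simp: PiE_iff)

lemma finite_\<Omega>: "finite \<Omega>"
  using finite_N finite_X by (auto intro: finite_PiE)

lemma ex_\<Omega>: "\<exists>z. z \<in> \<Omega>"
  using nonempty_X by (metis PiE_eq_empty_iff all_not_in_conv)

lemma D_zero_add:
  assumes "n \<in> N" "f \<in> insert (\<lambda>_. 0) (D n)" "g \<in> insert (\<lambda>_. 0) (D n)"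
  shows "(\<lambda>a. f a + g a) \<in> insert (\<lambda>_. 0) (D n)"
  using assms coherent_add[OF coherent_D] by auto

lemma D_zero_scale:
  assumes "n \<in> N" "f \<in> insert (\<lambda>_. 0) (D n)" "c \<ge> 0"
  shows "(\<lambda>a. c * f a) \<in> insert (\<lambda>_. 0) (D n)"
  using assms coherent_scale[OF coherent_D] by (cases "c = 0") auto

lemma D_zero_sum:
  assumes "n \<in> N" "finite K" "\<And>k. k \<in> K \<Longrightarrow> f k \<in> insert (\<lambda>_. 0) (D n)"
  shows "(\<lambda>a. \<Sum>k\<in>K. f k a) \<in> insert (\<lambda>_. 0) (D n)"
  using assms(2,3)
proof (induction K rule: finite_induct)
  case (insert k K)
  then show ?case
    using D_zero_add[OF assms(1), of "f k" "\<lambda>a. \<Sum>k\<in>K. f k a"] by simp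
qed simp

lemma sectional_section:
  "f \<in> sectional n \<Longrightarrow> z \<in> \<Omega> \<Longrightarrow> (\<lambda>a. f (z(n := a))) \<in> insert (\<lambda>_. 0) (D n)"
  by (simp add: sectional_def)

lemma sum_cone_gambles: "f \<in> sum_cone M \<Longrightarrow> f \<in> gambles \<Omega>"
  by (induction rule: sum_cone.induct)
     (auto simp: nonneg_gambles_def sectional_def gambles_def)

lemma nonneg_gambles_sectional:
  assumes "n \<in> N"
  shows "nonneg_gambles \<subseteq> sectional n"
proof
  fix f assume f: "f \<in> nonneg_gambles"
  have "(\<lambda>a. f (z(n := a))) \<in> insert (\<lambda>_. 0) (D n)" for z
  proof (cases "(\<lambda>a. f (z(n := a))) = (\<lambda>_. 0)")
    case False
    then have "(\<lambda>a. f (z(n := a))) \<in> pos_gambles (X n)"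
      using f update_notin_\<Omega>[OF assms]
      by (auto simp: pos_gambles_def nonneg_gambles_def gambles_def)
    then show ?thesis using coherent_pos[OF coherent_D[OF assms]] by simp
  qed simp
  with f show "f \<in> sectional n"
    by (simp add: sectional_def nonneg_gambles_def)
qed

lemma sectional_add:
  assumes "n \<in> N" "f \<in> sectional n" "g \<in> sectional n"
  shows "(\<lambda>z. f z + g z) \<in> sectional n"
  using assms D_zero_add[OF assms(1)] unfolding sectional_def gambles_def by auto

text \<open>If one of two cancelling sections were nonzero, both would be desirable, and so would
  their sum, which is zero. This contradicts (D1).\<close>

lemma sectional_add_eq_zero:
  assumes n: "n \<in> N" and f: "f \<in> sectional n" and g: "g \<in> sectional n" and "\<And>z. f z + g z = 0"
  shows "f z = 0"
proof (cases "z \<in> \<Omega>")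
  case True
  let ?f = "\<lambda>a. f (z(n := a))" and ?g = "\<lambda>a. g (z(n := a))"
  have "?f = (\<lambda>_. 0)"
  proof (rule ccontr)
    assume "?f \<noteq> (\<lambda>_. 0)"
    moreover have "?g \<noteq> (\<lambda>_. 0)"
    proof
      assume "?g = (\<lambda>_. 0)"
      then have "?f a = 0" for a
        using assms(4)[of "z(n := a)"] by (simp add: fun_eq_iff)
      with \<open>?f \<noteq> (\<lambda>_. 0)\<close> show False by blast
    qed
    ultimately have "?f \<in> D n" "?g \<in> D n"
      using sectional_section[OF f True] sectional_section[OF g True] by blast+
    then have "(\<lambda>a. ?f a + ?g a) \<in> D n"
      by (rule coherent_add[OF coherent_D[OF n]])
    then show False
      using coherent_nonzero[OF coherent_D[OF n]] assms(4) by auto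
  qed
  then show ?thesis by (metis fun_upd_triv)
qed (use f in \<open>auto simp: sectional_def gambles_def\<close>)

lemma sum_cone_mono: "M \<subseteq> M' \<Longrightarrow> sum_cone M \<subseteq> sum_cone M'"
proof
  fix f assume "M \<subseteq> M'" and "f \<in> sum_cone M"
  from this(2,1) show "f \<in> sum_cone M'"
    by (induction rule: sum_cone.induct) (auto intro: sum_cone.intros)
qed

text \<open>Along each direction in \<open>M\<close> the factor \<open>q\<close> is constant, so it
  acts on every section as a nonnegative scalar.\<close>

lemma sum_cone_mult:
  assumes "f \<in> sum_cone M" "M \<subseteq> N" "\<And>z. q z \<ge> 0" "\<And>n z a. n \<in> M \<Longrightarrow> q (z(n := a)) = q z"
  shows "(\<lambda>z. q z * f z) \<in> sum_cone M"
  using assms(1)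
proof (induction rule: sum_cone.induct)
  case (nonneg f)
  then show ?case
    using assms(3) by (intro sum_cone.nonneg) (auto simp: nonneg_gambles_def gambles_def)
next
  case (sectional n f)
  then have "(\<lambda>z. q z * f z) \<in> sectional n"
    using D_zero_scale[of n] assms(2-4) by (auto simp: sectional_def gambles_def subset_iff)
  then show ?case by (rule sum_cone.sectional[OF sectional(1)])
next
  case (add f g)
  then show ?case using sum_cone.add by (force simp: distrib_left)
qed

lemma sum_cone_scale: "f \<in> sum_cone M \<Longrightarrow> M \<subseteq> N \<Longrightarrow> c \<ge> 0 \<Longrightarrow> (\<lambda>z. c * f z) \<in> sum_cone M"
  by (rule sum_cone_mult[where q = "\<lambda>_. c"]) auto

text \<open>All summands in direction \<open>i\<close> merge into one, because
  \<open>sectional i\<close> is closed under addition.\<close>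

lemma sum_cone_insert:
  assumes "f \<in> sum_cone (insert i M)" "i \<in> N"
  shows "\<exists>s\<in>sum_cone M. \<exists>h\<in>sectional i. f = (\<lambda>z. s z + h z)"
  using assms(1)
proof (induction rule: sum_cone.induct)
  have zero: "(\<lambda>_. 0) \<in> nonneg_gambles" "(\<lambda>_. 0) \<in> sectional i"
    by (auto simp: nonneg_gambles_def sectional_def gambles_def)
  {
    case (nonneg f)
    then show ?case
      using zero by (intro bexI[of _ f] bexI[of _ "\<lambda>_. 0"]) (auto intro: sum_cone.intros)
  next
    case (sectional n f)
    show ?case
    proof (cases "n = i")
      case True
      then show ?thesis
        using zero sectional by (intro bexI[of _ "\<lambda>_. 0"] bexI[of _ f]) (auto intro: sum_cone.intros)
    next
      case False
      then show ?thesis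
        using zero sectional by (intro bexI[of _ f] bexI[of _ "\<lambda>_. 0"]) (auto intro: sum_cone.intros)
    qed
  next
    case (add f g)
    then obtain s h s' h' where "s \<in> sum_cone M" "s' \<in> sum_cone M" "h \<in> sectional i" "h' \<in> sectional i"
      and "f = (\<lambda>z. s z + h z)" "g = (\<lambda>z. s' z + h' z)" by blast
    then show ?case
      using sectional_add[OF assms(2), of h h'] sum_cone.add[of s M s']
      by (intro bexI[of _ "\<lambda>z. s z + s' z"] bexI[of _ "\<lambda>z. h z + h' z"]) (auto simp: fun_eq_iff)
  }
qed

section \<open>Averaging out one coordinate\<close>

lemma average_add: "average i p (\<lambda>z. f z + g z) = (\<lambda>z. average i p f z + average i p g z)"
  by (auto simp: average_def fun_eq_iff distrib_left sum.distrib)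

text \<open>Averaging over \<open>i\<close> commutes with taking sections in another direction
  \<open>n\<close>: a section of the average is a positive combination of sections of
  \<open>f\<close>, hence zero or desirable.\<close>

lemma average_sum_cone:
  assumes "f \<in> sum_cone M" "M \<subseteq> N" "i \<in> N" "i \<notin> M" "\<And>a. a \<in> X i \<Longrightarrow> p a > 0"
  shows "average i p f \<in> sum_cone M"
  using assms(1)
proof (induction rule: sum_cone.induct)
  case (nonneg f)
  then show ?case
    using assms(5)
    by (intro sum_cone.nonneg)
       (auto simp: nonneg_gambles_def gambles_def average_def less_imp_le intro!: sum_nonneg)
next
  case (sectional n f)
  then have n: "n \<in> N" "n \<noteq> i" using assms by auto
  have "(\<lambda>b. average i p f (z(n := b))) \<in> insert (\<lambda>_. 0) (D n)" if z: "z \<in> \<Omega>" for z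
  proof -
    \<comment> \<open>For \<open>b\<close> outside \<open>X n\<close> both sides are zero, so the
      identity holds for every \<open>b\<close>.\<close>
    have "average i p f (z(n := b)) = (\<Sum>a\<in>X i. p a * f ((z(i := a))(n := b)))" for b
    proof (cases "b \<in> X n")
      case True
      then show ?thesis
        using update_in_\<Omega>[OF z n(1) True] n(2) by (simp add: average_def fun_upd_twist)
    next
      case False
      then show ?thesis
        using update_notin_\<Omega>[OF n(1) False] sectional(2)
        by (simp add: average_def sectional_def gambles_def)
    qed
    moreover have "(\<lambda>b. \<Sum>a\<in>X i. p a * f ((z(i := a))(n := b))) \<in> insert (\<lambda>_. 0) (D n)"
      using sectional_section[OF sectional(2) update_in_\<Omega>[OF z assms(3)]] assms(5) finite_X assms(3)
      by (intro D_zero_sum[OF n(1)] D_zero_scale[OF n(1)]) (auto simp: less_imp_le)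
    ultimately show ?thesis by presburger
  qed
  then have "average i p f \<in> sectional n"
    by (simp add: sectional_def gambles_def average_def)
  then show ?case by (rule sum_cone.sectional[OF sectional(1)])
next
  case (add f g)
  then show ?case by (simp add: average_add sum_cone.add)
qed

text \<open>Since \<open>\<Omega>\<close> is finite, \<open>h\<close> has finitely many sections,
  and one \<open>p\<close> gives all nonzero ones a positive mean. The average is therefore positive
  at every point whose section is nonzero, and it can vanish only if \<open>h\<close> does.\<close>

lemma sectional_average:
  assumes i: "i \<in> N" and h: "h \<in> sectional i"
  shows "\<exists>p. (\<forall>a\<in>X i. p a > 0) \<and> average i p h \<in> nonneg_gambles \<and>
    (average i p h = (\<lambda>_. 0) \<longrightarrow> h = (\<lambda>_. 0))"
proof -
  let ?sec = "\<lambda>z a. h (z(i := a))"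
  have sec: "?sec z \<in> ?sec ` \<Omega> \<inter> D i" if "?sec z \<noteq> (\<lambda>_. 0)" "z \<in> \<Omega>" for z
    using sectional_section[OF h that(2)] that by blast
  have "finite (?sec ` \<Omega> \<inter> D i)"
    using finite_\<Omega> by simp
  then obtain p where p: "\<forall>a\<in>X i. p a > 0"
    and pos: "\<forall>g\<in>?sec ` \<Omega> \<inter> D i. (\<Sum>a\<in>X i. p a * g a) > 0"
    using coherent_positive_functional[OF coherent_D[OF i] finite_X[OF i] _ Int_lower2] by blast
  have avg: "average i p h z > 0" if "?sec z \<noteq> (\<lambda>_. 0)" "z \<in> \<Omega>" for z
    using bspec[OF pos sec[OF that]] that(2) unfolding average_def by presburger
  have "average i p h z \<ge> 0" for z
  proof (cases "z \<in> \<Omega> \<and> ?sec z \<noteq> (\<lambda>_. 0)")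
    case True
    then show ?thesis using avg[of z] by simp
  next
    case False
    then show ?thesis by (auto simp: average_def fun_eq_iff)
  qed
  then have "average i p h \<in> nonneg_gambles"
    by (auto simp: nonneg_gambles_def gambles_def average_def)
  moreover have "h = (\<lambda>_. 0)" if "average i p h = (\<lambda>_. 0)"
  proof
    fix z
    show "h z = 0"
    proof (cases "z \<in> \<Omega>")
      case True
      then have "?sec z = (\<lambda>_. 0)"
        using avg[of z] that by force
      then show ?thesis by (metis fun_upd_triv)
    qed (use h in \<open>auto simp: sectional_def gambles_def\<close>)
  qed
  ultimately show ?thesis using p by blast
qed

text \<open>Induction on the set of directions: averaging out the new direction shows that its
  summands cancel only if they vanish, which leaves \<open>f\<close> and its negative in the smaller
  cone.\<close>

lemma sum_cone_pointed:
  assumes "M \<subseteq> N" "f \<in> sum_cone M" "(\<lambda>z. - f z) \<in> sum_cone M"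
  shows "f = (\<lambda>_. 0)"
proof -
  have "finite M" using assms(1) finite_N finite_subset by blast
  then show ?thesis
    using assms
  proof (induction M arbitrary: f rule: finite_induct)
    case empty
    have "g \<in> nonneg_gambles" if "g \<in> sum_cone {}" for g
      using that
      by (induction rule: sum_cone.induct) (auto simp: nonneg_gambles_def gambles_def)
    from this[OF empty(2)] this[OF empty(3)] show ?case
      by (auto simp: nonneg_gambles_def fun_eq_iff intro: antisym)
  next
    case (insert i M)
    then have i: "i \<in> N" and M: "M \<subseteq> N" by auto
    obtain s h where s: "s \<in> sum_cone M" and h: "h \<in> sectional i" and f: "f = (\<lambda>z. s z + h z)"
      using sum_cone_insert[OF insert.prems(2) i] by blast
    obtain s' h' where s': "s' \<in> sum_cone M" and h': "h' \<in> sectional i"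
      and f': "(\<lambda>z. - f z) = (\<lambda>z. s' z + h' z)"
      using sum_cone_insert[OF insert.prems(3) i] by blast
    define H where "H = (\<lambda>z. h z + h' z)"
    define S where "S = (\<lambda>z. s z + s' z)"
    have "S z + H z = 0" for z
      using fun_cong[OF f', of z] f by (simp add: S_def H_def)
    then have SH: "S z = - H z" for z by (simp add: eq_neg_iff_add_eq_0)
    \<comment> \<open>The weights are adapted to the total \<open>H\<close> of the two summands in
      direction \<open>i\<close>, not to \<open>h\<close> and \<open>h'\<close> separately.\<close>
    have "H \<in> sectional i"
      unfolding H_def by (rule sectional_add[OF i h h'])
    then obtain p where p: "\<And>a. a \<in> X i \<Longrightarrow> p a > 0" and avg: "average i p H \<in> nonneg_gambles"
      and zero: "average i p H = (\<lambda>_. 0) \<Longrightarrow> H = (\<lambda>_. 0)"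
      using sectional_average[OF i] by blast
    have "S \<in> sum_cone M"
      unfolding S_def using s s' by (rule sum_cone.add)
    then have "average i p S \<in> sum_cone M"
      using M i insert.hyps(2) p by (rule average_sum_cone)
    moreover have "average i p S = (\<lambda>z. - average i p H z)"
      by (auto simp: average_def SH sum_negf fun_eq_iff)
    \<comment> \<open>The average of \<open>H\<close> lies in the smaller cone because it is
      nonnegative, and its negative because it is the average of \<open>S\<close>.\<close>
    ultimately have "average i p H = (\<lambda>_. 0)"
      using insert.IH[OF M, of "average i p H"] sum_cone.nonneg[OF avg] by simp
    then have "H = (\<lambda>_. 0)" by (rule zero)
    then have hh': "h z + h' z = 0" for z
      by (metis H_def)
    then have "h z = 0" for z
      by (rule sectional_add_eq_zero[OF i h h'])
    moreover from this hh' have "h' z = 0" for z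
      by simp
    ultimately have "f = s" "(\<lambda>z. - f z) = s'"
      using f f' by simp_all
    then show ?case using insert.IH[OF M] s s' by simp
  qed
qed

section \<open>Eliminating and fixing coordinates\<close>

definition independent_of :: "'i \<Rightarrow> (('i \<Rightarrow> 'a) \<Rightarrow> real) \<Rightarrow> bool" where
  "independent_of i f \<longleftrightarrow> (\<forall>z\<in>\<Omega>. \<forall>a\<in>X i. f (z(i := a)) = f z)"

text \<open>With \<^term>\<open>q\<close> constant this drops a coordinate on which \<^term>\<open>f\<close> does not depend; with
  \<^term>\<open>q\<close> the indicator of \<^term>\<open>c\<close> it undoes conditioning on that coordinate.\<close>

lemma sum_cone_eliminate:
  assumes "(\<lambda>z. q (z i) * f z) \<in> sum_cone (insert i M)" "M \<subseteq> N" "i \<in> N" "i \<notin> M"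
    and "f \<in> gambles \<Omega>" "independent_of i f"
    and "\<And>a. q a \<ge> 0" "c \<in> X i" "q c > 0"
  shows "f \<in> sum_cone M"
proof -
  let ?g = "\<lambda>z. q (z i) * f z"
  obtain s h where s: "s \<in> sum_cone M" and h: "h \<in> sectional i" and g: "?g = (\<lambda>z. s z + h z)"
    using sum_cone_insert[OF assms(1,3)] by blast
  obtain p where p: "\<And>a. a \<in> X i \<Longrightarrow> p a > 0" and avg: "average i p h \<in> nonneg_gambles"
    using sectional_average[OF assms(3) h] by blast
  \<comment> \<open>Averaging makes the summand in direction \<open>i\<close> nonnegative, so
    direction \<open>i\<close> is no longer among the admissible ones.\<close>
  have "average i p ?g \<in> sum_cone M"
    unfolding g average_add
    by (intro sum_cone.add average_sum_cone s assms sum_cone.nonneg avg p)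
  \<comment> \<open>As \<open>f\<close> does not depend on coordinate \<open>i\<close>, it factors
    out of the average; the term for \<open>c\<close> makes the remaining factor \<open>w\<close>
    positive.\<close>
  moreover define w where "w = (\<Sum>a\<in>X i. p a * q a)"
  have "average i p ?g = (\<lambda>z. w * f z)"
  proof
    fix z
    show "average i p ?g z = w * f z"
    proof (cases "z \<in> \<Omega>")
      case True
      then show ?thesis
        using assms(6)
        by (auto simp: average_def independent_of_def w_def sum_distrib_right mult.assoc intro!: sum.cong)
    next
      case False
      then show ?thesis using assms(5) by (simp add: average_def gambles_def)
    qed
  qed
  moreover have "w > 0"
    unfolding w_def using p assms(7-9) finite_X[OF assms(3)]
    by (intro sum_pos2[of _ c]) (auto simp: less_imp_le)
  ultimately have "(\<lambda>z. w * f z) \<in> sum_cone M" "w > 0"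
    by simp_all
  then show ?thesis
    using sum_cone_scale[of "\<lambda>z. w * f z" M "1 / w"] assms(2) by (simp only: mult.assoc[symmetric]) simp
qed

lemma sum_cone_drop:
  assumes "f \<in> sum_cone (insert i M)" "M \<subseteq> N" "i \<in> N" "i \<notin> M" "independent_of i f"
  shows "f \<in> sum_cone M"
proof -
  obtain c where "c \<in> X i" using nonempty_X[OF assms(3)] by blast
  with assms sum_cone_gambles[OF assms(1)] show ?thesis
    by (intro sum_cone_eliminate[of "\<lambda>_. 1" i f M c]) simp_all
qed

lemma sum_cone_drop_set:
  assumes "finite J" "f \<in> sum_cone (J \<union> M)" "J \<union> M \<subseteq> N" "J \<inter> M = {}"
    and "\<And>i. i \<in> J \<Longrightarrow> independent_of i f"
  shows "f \<in> sum_cone M"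
  using assms
proof (induction J rule: finite_induct)
  case (insert i J)
  then have "f \<in> sum_cone (insert i (J \<union> M))" by simp
  then have "f \<in> sum_cone (J \<union> M)"
    by (rule sum_cone_drop) (use insert in simp_all)
  with insert.prems show ?case
    by (intro insert.IH) simp_all
qed simp

text \<open>This is the core of independence for a single conditioning coordinate; larger sets are
  reached one coordinate at a time.\<close>

lemma fix_coordinate_sum_cone_iff:
  assumes "i \<in> N" "c \<in> X i" "f \<in> gambles \<Omega>" "independent_of i f"
  shows "(\<lambda>z. of_bool (z i = c) * f z) \<in> sum_cone N - {\<lambda>_. 0} \<longleftrightarrow> f \<in> sum_cone N - {\<lambda>_. 0}"
    (is "?g \<in> _ \<longleftrightarrow> _")
proof -
  have mono: "sum_cone (N - {i}) \<subseteq> sum_cone N" by (rule sum_cone_mono) blast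
  have "?g \<in> sum_cone N \<longleftrightarrow> f \<in> sum_cone N"
  proof
    assume "?g \<in> sum_cone N"
    then have "f \<in> sum_cone (N - {i})"
      using assms by (intro sum_cone_eliminate[of "\<lambda>a. of_bool (a = c)" i f _ c]) (simp_all add: insert_absorb)
    then show "f \<in> sum_cone N"
      using mono by blast
  next
    \<comment> \<open>Direction \<open>i\<close> is dropped first: the indicator of \<open>c\<close>
      is constant along every remaining direction, so multiplying by it preserves the cone.\<close>
    assume "f \<in> sum_cone N"
    then have "f \<in> sum_cone (insert i (N - {i}))"
      using assms(1) by (simp add: insert_absorb)
    then have "f \<in> sum_cone (N - {i})"
      by (rule sum_cone_drop) (use assms in simp_all)
    then have "?g \<in> sum_cone (N - {i})"
      by (rule sum_cone_mult) auto
    then show "?g \<in> sum_cone N"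
      using mono by blast
  qed
  moreover have "?g = (\<lambda>_. 0) \<longleftrightarrow> f = (\<lambda>_. 0)"
  proof
    assume g: "?g = (\<lambda>_. 0)"
    show "f = (\<lambda>_. 0)"
    proof
      fix z
      \<comment> \<open>For \<open>z\<close> in \<open>\<Omega>\<close> the value of
        \<open>?g\<close> at \<open>z(i := c)\<close> is \<open>f z\<close>.\<close>
      show "f z = 0"
        using fun_cong[OF g, of "z(i := c)"] assms
        by (cases "z \<in> \<Omega>") (auto simp: independent_of_def gambles_def)
    qed
  qed simp
  ultimately show ?thesis by simp
qed

lemma fix_coordinates_sum_cone_iff:
  assumes "finite I" "I \<subseteq> N" "\<And>i. i \<in> I \<Longrightarrow> x i \<in> X i" "f \<in> gambles \<Omega>"
    and "\<And>i. i \<in> I \<Longrightarrow> independent_of i f"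
  shows "(\<lambda>z. of_bool (\<forall>i\<in>I. z i = x i) * f z) \<in> sum_cone N - {\<lambda>_. 0} \<longleftrightarrow>
    f \<in> sum_cone N - {\<lambda>_. 0}"
  using assms
proof (induction I rule: finite_induct)
  case (insert i I)
  let ?g = "\<lambda>z. of_bool (\<forall>i\<in>I. z i = x i) * f z"
  have "?g \<in> gambles \<Omega>"
    using insert.prems(3) by (simp add: gambles_def)
  \<comment> \<open>The indicator of the coordinates already fixed does not involve
    \<open>i\<close>, so the one-coordinate case applies to \<open>?g\<close>.\<close>
  moreover have "(\<forall>j\<in>I. (z(i := a)) j = x j) \<longleftrightarrow> (\<forall>j\<in>I. z j = x j)" for z a
    using insert.hyps(2) by auto
  then have "independent_of i ?g"
    using insert.prems(4)[of i] unfolding independent_of_def by simp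
  ultimately have "(\<lambda>z. of_bool (z i = x i) * ?g z) \<in> sum_cone N - {\<lambda>_. 0} \<longleftrightarrow>
      ?g \<in> sum_cone N - {\<lambda>_. 0}"
    using insert.prems by (intro fix_coordinate_sum_cone_iff) auto
  moreover have "(\<lambda>z. of_bool (z i = x i) * ?g z) = (\<lambda>z. of_bool (\<forall>i\<in>insert i I. z i = x i) * f z)"
    by auto
  moreover have "?g \<in> sum_cone N - {\<lambda>_. 0} \<longleftrightarrow> f \<in> sum_cone N - {\<lambda>_. 0}"
    using insert.prems by (intro insert.IH) auto
  ultimately show ?case by (simp only:)
qed simp

section \<open>The independent natural extension\<close>

definition irr_gamble :: "'i \<Rightarrow> ('i \<Rightarrow> 'a) \<Rightarrow> ('a \<Rightarrow> real) \<Rightarrow> ('i \<Rightarrow> 'a) \<Rightarrow> real" where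
  "irr_gamble n y g = (\<lambda>x. cyl_ext X N (N - {n}) (indicator {y}) x *
        cyl_ext X N {n} (singleton_gamble X n g) x)"

lemma irr_gamble_eq:
  assumes "n \<in> N"
  shows "irr_gamble n y g = (\<lambda>z. if z \<in> \<Omega> \<and> restrict z (N - {n}) = y then g (z n) else 0)"
proof
  fix z
  have "restrict z {n} \<in> PiE {n} X" if "z \<in> \<Omega>"
    using that assms by (simp add: PiE_iff)
  then show "irr_gamble n y g z = (if z \<in> \<Omega> \<and> restrict z (N - {n}) = y then g (z n) else 0)"
    by (simp add: irr_gamble_def cyl_ext_def singleton_gamble_def)
qed

lemma restrict_update: "restrict (z(n := a)) (N - {n}) = restrict z (N - {n})"
  by (auto simp: restrict_def)

text \<open>The section through \<open>z\<close> is \<open>g\<close> if the other coordinates of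
  \<open>z\<close> form \<open>y\<close>, and zero otherwise.\<close>

lemma irr_gamble_sectional:
  assumes "n \<in> N" "g \<in> D n"
  shows "irr_gamble n y g \<in> sectional n"
proof -
  have "(\<lambda>a. irr_gamble n y g (z(n := a))) \<in> insert (\<lambda>_. 0) (D n)" if z: "z \<in> \<Omega>" for z
  proof -
    have "irr_gamble n y g (z(n := a)) = (if restrict z (N - {n}) = y then g a else 0)" for a
      using update_in_\<Omega>[OF z assms(1), of a] update_notin_\<Omega>[OF assms(1), of a z]
        coherent_gambles[OF coherent_D[OF assms(1)] assms(2), of a]
      by (cases "a \<in> X n") (simp_all add: irr_gamble_eq[OF assms(1)] restrict_update)
    then show ?thesis
      using assms(2) by (cases "restrict z (N - {n}) = y") simp_all
  qed
  then show ?thesis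
    by (simp add: sectional_def gambles_def irr_gamble_eq[OF assms(1)])
qed

lemma irr_gamble_nonzero:
  assumes "n \<in> N" "g \<in> D n" "y \<in> PiE (N - {n}) X"
  shows "irr_gamble n y g \<noteq> (\<lambda>_. 0)"
proof
  assume "irr_gamble n y g = (\<lambda>_. 0)"
  then have zero: "irr_gamble n y g (y(n := a)) = 0" for a by simp
  have "g a = 0" for a
  proof (cases "a \<in> X n")
    case True
    then have "y(n := a) \<in> \<Omega>" "restrict (y(n := a)) (N - {n}) = y"
      using assms(1,3) by (auto simp: PiE_iff extensional_def fun_eq_iff)
    then show ?thesis using zero[of a] by (simp add: irr_gamble_eq[OF assms(1)])
  qed (rule coherent_gambles[OF coherent_D[OF assms(1)] assms(2)])
  then show False
    using coherent_nonzero[OF coherent_D[OF assms(1)] assms(2)] by auto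
qed

lemma A_irr_eq: "A_irr X N n (D n) = posi {irr_gamble n y g | y g. g \<in> D n \<and> y \<in> PiE (N - {n}) X}"
  by (simp add: A_irr_def irr_gamble_def)

text \<open>Pointedness is what keeps the cone closed under addition once zero is removed.\<close>

lemma sum_cone_add_nonzero:
  assumes "f \<in> sum_cone N - {\<lambda>_. 0}" "g \<in> sum_cone N - {\<lambda>_. 0}"
  shows "(\<lambda>z. f z + g z) \<in> sum_cone N - {\<lambda>_. 0}"
proof -
  have "(\<lambda>z. f z + g z) \<noteq> (\<lambda>_. 0)"
  proof
    assume "(\<lambda>z. f z + g z) = (\<lambda>_. 0)"
    then have "(\<lambda>z. - f z) = g"
      by (auto simp: fun_eq_iff neg_eq_iff_add_eq_0)
    then show False
      using sum_cone_pointed[of N f] assms by auto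
  qed
  then show ?thesis using assms sum_cone.add[of f N g] by simp
qed

lemma sum_cone_scale_nonzero:
  assumes "f \<in> sum_cone N - {\<lambda>_. 0}" "c > 0"
  shows "(\<lambda>z. c * f z) \<in> sum_cone N - {\<lambda>_. 0}"
  using assms sum_cone_scale[of f N c] by (auto simp: fun_eq_iff)

lemma pos_gambles_eq: "pos_gambles \<Omega> = nonneg_gambles - {\<lambda>_. 0}"
  by (auto simp: pos_gambles_def nonneg_gambles_def gambles_def)

lemma indep_nat_ext_subset: "indep_nat_ext X N D \<subseteq> sum_cone N - {\<lambda>_. 0}"
proof -
  have "A_irr X N n (D n) \<subseteq> sum_cone N - {\<lambda>_. 0}" if n: "n \<in> N" for n
    unfolding A_irr_eq
    using irr_gamble_sectional[OF n] irr_gamble_nonzero[OF n] n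
    by (intro posi_least sum_cone_add_nonzero sum_cone_scale_nonzero)
       (auto intro: sum_cone.sectional)
  then show ?thesis
    unfolding indep_nat_ext_def pos_gambles_eq
    by (intro posi_least sum_cone_add_nonzero sum_cone_scale_nonzero)
       (auto intro: sum_cone.nonneg)
qed

lemma indep_nat_ext_add_zero:
  assumes "f \<in> insert (\<lambda>_. 0) (indep_nat_ext X N D)" "g \<in> insert (\<lambda>_. 0) (indep_nat_ext X N D)"
  shows "(\<lambda>z. f z + g z) \<in> insert (\<lambda>_. 0) (indep_nat_ext X N D)"
  using assms posi_add unfolding indep_nat_ext_def by auto

text \<open>The lines in direction \<open>n\<close> partition \<open>\<Omega>\<close> and are
  indexed by the other coordinates \<open>y\<close>; at \<open>z\<close> only the summand of the
  line through \<open>z\<close> survives.\<close>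

lemma sectional_decomposition:
  assumes n: "n \<in> N" and f: "f \<in> sectional n"
  shows "f z = (\<Sum>y\<in>PiE (N - {n}) X. irr_gamble n y (\<lambda>a. f (y(n := a))) z)"
proof (cases "z \<in> \<Omega>")
  case True
  have "restrict z (N - {n}) \<in> PiE (N - {n}) X"
    using True by (auto simp: PiE_iff)
  moreover have "(restrict z (N - {n}))(n := z n) = z"
    using True by (auto simp: PiE_iff fun_eq_iff extensional_def)
  moreover have "finite (PiE (N - {n}) X)"
    using finite_N finite_X by (auto intro: finite_PiE)
  moreover have "irr_gamble n y (\<lambda>a. f (y(n := a))) z =
      (if y = restrict z (N - {n}) then f (y(n := z n)) else 0)" for y
    using True by (auto simp: irr_gamble_eq[OF n])
  ultimately show ?thesis by simp
next
  case False
  then show ?thesis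
    using f by (simp add: irr_gamble_eq[OF n] sectional_def gambles_def)
qed

lemma sectional_subset_indep_nat_ext:
  assumes n: "n \<in> N" and f: "f \<in> sectional n"
  shows "f \<in> insert (\<lambda>_. 0) (indep_nat_ext X N D)"
proof -
  have summand: "irr_gamble n y (\<lambda>a. f (y(n := a))) \<in> insert (\<lambda>_. 0) (indep_nat_ext X N D)"
    if y: "y \<in> PiE (N - {n}) X" for y
  proof -
    \<comment> \<open>Sections are taken at points of \<open>\<Omega>\<close>, so \<open>y\<close>
      is completed by an arbitrary \<open>c\<close>, which the update by \<open>a\<close> then
      overwrites.\<close>
    obtain c where c: "c \<in> X n" using nonempty_X[OF n] by blast
    have "y(n := c) \<in> \<Omega>"
      using y n c by (auto simp: PiE_iff extensional_def)
    then have "(\<lambda>a. f (y(n := a))) \<in> insert (\<lambda>_. 0) (D n)"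
      using sectional_section[OF f, of "y(n := c)"] by simp
    then consider "(\<lambda>a. f (y(n := a))) = (\<lambda>_. 0)" | "(\<lambda>a. f (y(n := a))) \<in> D n" by blast
    then show ?thesis
    proof cases
      case 1
      then show ?thesis by (simp add: irr_gamble_eq[OF n] cong: if_cong)
    next
      case 2
      then have "irr_gamble n y (\<lambda>a. f (y(n := a))) \<in> A_irr X N n (D n)"
        unfolding A_irr_eq using y by (intro subsetD[OF subset_posi]) blast
      then show ?thesis
        unfolding indep_nat_ext_def using n by (intro insertI2 subsetD[OF subset_posi]) blast
    qed
  qed
  have "(\<lambda>z. \<Sum>y\<in>K. irr_gamble n y (\<lambda>a. f (y(n := a))) z) \<in> insert (\<lambda>_. 0) (indep_nat_ext X N D)"
    if "finite K" "K \<subseteq> PiE (N - {n}) X" for K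
    using that
  proof (induction K rule: finite_induct)
    case (insert y K)
    then have "(\<lambda>z. irr_gamble n y (\<lambda>a. f (y(n := a))) z + (\<Sum>y\<in>K. irr_gamble n y (\<lambda>a. f (y(n := a))) z))
        \<in> insert (\<lambda>_. 0) (indep_nat_ext X N D)"
      by (intro indep_nat_ext_add_zero summand insert.IH) auto
    with insert.hyps show ?case by (simp del: insert_iff fun_upd_apply)
  qed simp
  moreover have "finite (PiE (N - {n}) X)"
    using finite_N finite_X by (auto intro: finite_PiE)
  ultimately show ?thesis
    using sectional_decomposition[OF n f] by (metis (no_types, lifting) ext order_refl)
qed

text \<open>This transfers the averaging results to the extension. For the harder inclusion, every
  generator of the cone is zero or a positive combination of generators of the extension.\<close>

lemma indep_nat_ext_eq: "indep_nat_ext X N D = sum_cone N - {\<lambda>_. 0}"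
proof
  have "f \<in> insert (\<lambda>_. 0) (indep_nat_ext X N D)" if "f \<in> sum_cone N" for f
    using that
  proof (induction rule: sum_cone.induct)
    case (nonneg f)
    then have "f = (\<lambda>_. 0) \<or> f \<in> pos_gambles \<Omega>"
      by (auto simp: pos_gambles_eq)
    then show ?case
      unfolding indep_nat_ext_def using subset_posi by blast
  next
    case (sectional n f)
    then show ?case by (rule sectional_subset_indep_nat_ext)
  next
    case (add f g)
    from add.IH show ?case by (rule indep_nat_ext_add_zero)
  qed
  then show "sum_cone N - {\<lambda>_. 0} \<subseteq> indep_nat_ext X N D" by blast
qed (rule indep_nat_ext_subset)

lemma coherent_indep_nat_ext: "coherent \<Omega> (indep_nat_ext X N D)"
  unfolding coherent_def posi_eq_self_iff indep_nat_ext_eq pos_gambles_eq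
  using sum_cone_add_nonzero sum_cone_scale_nonzero
  by (auto intro: sum_cone.nonneg dest: sum_cone_gambles simp del: Diff_iff)

section \<open>Independence\<close>

lemma cyl_ext_cyl_ext:
  assumes "R \<subseteq> S" "S \<subseteq> N"
  shows "cyl_ext X N S (cyl_ext X S R f) = cyl_ext X N R f"
  using assms by (auto simp: cyl_ext_def fun_eq_iff PiE_iff Int_absorb1)

lemma cyl_ext_gambles: "cyl_ext X S R f \<in> gambles (PiE S X)"
  by (simp add: gambles_def cyl_ext_def)

lemma independent_of_cyl_ext:
  assumes "i \<in> N" "i \<notin> R"
  shows "independent_of i (cyl_ext X N R f)"
proof -
  have "restrict (z(i := a)) R = restrict z R" for z :: "'i \<Rightarrow> 'a" and a
    using assms(2) by (auto simp: restrict_def)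
  then show ?thesis
    using update_in_\<Omega>[OF _ assms(1)] by (simp add: independent_of_def cyl_ext_def)
qed

text \<open>Nested cylindrical extensions collapse, and the indicator of \<open>xI\<close> becomes a
  condition on single coordinates, the form to which \<open>fix_coordinates_sum_cone_iff\<close>
  applies.\<close>

lemma mem_marg_cond_iff:
  assumes "I \<subseteq> N" "R \<subseteq> N - I" "xI \<in> PiE I X"
  shows "f \<in> marg X (N - I) R (cond X N I E xI) \<longleftrightarrow> f \<in> gambles (PiE R X) \<and>
    (\<lambda>z. of_bool (\<forall>i\<in>I. z i = xI i) * cyl_ext X N R f z) \<in> E"
proof -
  have "restrict z I = xI \<longleftrightarrow> (\<forall>i\<in>I. z i = xI i)" for z
    using assms(3) by (auto simp: fun_eq_iff PiE_iff extensional_def restrict_def)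
  then have "(\<lambda>z. cyl_ext X N I (indicator {xI}) z * cyl_ext X N R f z) =
      (\<lambda>z. of_bool (\<forall>i\<in>I. z i = xI i) * cyl_ext X N R f z)"
    by (auto simp: cyl_ext_def indicator_def fun_eq_iff)
  then show ?thesis
    using assms(2) by (simp only: marg_def cond_def mem_Collect_eq cyl_ext_gambles cyl_ext_cyl_ext
        Diff_subset simp_thms)
qed

lemma independent_indep_nat_ext: "independent X N (indep_nat_ext X N D)"
proof -
  have "marg X (N - I) R (cond X N I (indep_nat_ext X N D) xI) = marg X N R (indep_nat_ext X N D)"
    if "I \<subseteq> N" "R \<subseteq> N" "I \<inter> R = {}" "xI \<in> PiE I X" for I R xI
  proof (rule set_eqI)
    fix f
    have "(\<lambda>z. of_bool (\<forall>i\<in>I. z i = xI i) * cyl_ext X N R f z) \<in> indep_nat_ext X N D \<longleftrightarrow>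
        cyl_ext X N R f \<in> indep_nat_ext X N D"
      unfolding indep_nat_ext_eq
    proof (rule fix_coordinates_sum_cone_iff)
      show "finite I" using that(1) finite_N finite_subset by blast
    qed (use that in \<open>auto intro: cyl_ext_gambles independent_of_cyl_ext\<close>)
    moreover have "R \<subseteq> N - I" using that by blast
    ultimately show "f \<in> marg X (N - I) R (cond X N I (indep_nat_ext X N D) xI) \<longleftrightarrow>
        f \<in> marg X N R (indep_nat_ext X N D)"
      using that mem_marg_cond_iff[of I R xI f] by (simp add: marg_def)
  qed
  then show ?thesis
    using coherent_indep_nat_ext by (simp add: independent_def)
qed

section \<open>Marginals\<close>

lemma sum_cone_singleton:
  assumes "n \<in> N"
  shows "sum_cone {n} \<subseteq> sectional n"
proof
  fix f assume "f \<in> sum_cone {n}"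
  then show "f \<in> sectional n"
    by (induction rule: sum_cone.induct)
       (use nonneg_gambles_sectional[OF assms] sectional_add[OF assms] in auto)
qed

lemma cyl_ext_singleton_section:
  assumes "n \<in> N" "z \<in> \<Omega>" "\<And>a. a \<notin> X n \<Longrightarrow> g a = 0"
  shows "cyl_ext X N {n} (singleton_gamble X n g) (z(n := a)) = g a"
  using update_in_\<Omega>[OF assms(2,1), of a] update_notin_\<Omega>[OF assms(1), of a z] assms(3)[of a]
  by (cases "a \<in> X n") (auto simp: cyl_ext_def singleton_gamble_def)

lemma singleton_gamble_surj:
  assumes "f \<in> gambles (PiE {n} X)"
  shows "\<exists>g. f = singleton_gamble X n g \<and> (\<forall>a. a \<notin> X n \<longrightarrow> g a = 0)"
proof -
  \<comment> \<open>\<open>\<lambda>i\<in>{n}. a\<close> is the unique point of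
    \<open>PiE {n} X\<close> with coordinate \<open>a\<close>; the value 0 elsewhere makes
    \<open>g\<close> a gamble on \<open>X n\<close>.\<close>
  define g where "g a = (if a \<in> X n then f (\<lambda>i\<in>{n}. a) else 0)" for a
  have "f x = singleton_gamble X n g x" for x
  proof (cases "x \<in> PiE {n} X")
    case True
    then have "x n \<in> X n" "(\<lambda>i\<in>{n}. x n) = x"
      by (auto simp: PiE_iff extensional_def fun_eq_iff)
    with True show ?thesis by (simp add: singleton_gamble_def g_def)
  next
    case False
    with assms show ?thesis by (simp add: singleton_gamble_def gambles_def)
  qed
  then show ?thesis by (intro exI[of _ g]) (auto simp: g_def)
qed

lemma marg_indep_nat_ext:
  assumes n: "n \<in> N"
  shows "marg X N {n} (indep_nat_ext X N D) = singleton_gamble X n ` D n"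
proof
  obtain z where z: "z \<in> \<Omega>" using ex_\<Omega> by blast
  show "marg X N {n} (indep_nat_ext X N D) \<subseteq> singleton_gamble X n ` D n"
  proof
    fix f assume f: "f \<in> marg X N {n} (indep_nat_ext X N D)"
    then obtain g where fg: "f = singleton_gamble X n g" and g: "\<And>a. a \<notin> X n \<Longrightarrow> g a = 0"
      using singleton_gamble_surj[of f n] by (auto simp: marg_def)
    let ?F = "cyl_ext X N {n} f"
    have F: "?F \<in> sum_cone N" "?F \<noteq> (\<lambda>_. 0)"
      using f by (auto simp: marg_def indep_nat_ext_eq)
    have "?F \<in> sum_cone {n}"
    proof (rule sum_cone_drop_set)
      show "?F \<in> sum_cone (N - {n} \<union> {n})"
        using F(1) n by (simp add: insert_absorb)
    qed (use finite_N n in \<open>auto intro: independent_of_cyl_ext\<close>)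
    then have "?F \<in> sectional n" using sum_cone_singleton[OF n] by blast
    then have "(\<lambda>a. ?F (z(n := a))) \<in> insert (\<lambda>_. 0) (D n)"
      using z by (rule sectional_section)
    then have "g \<in> insert (\<lambda>_. 0) (D n)"
      using cyl_ext_singleton_section[OF n z g] fg by simp
    moreover have "g \<noteq> (\<lambda>_. 0)"
      using F(2) fg by (auto simp: cyl_ext_def singleton_gamble_def)
    ultimately show "f \<in> singleton_gamble X n ` D n" using fg by blast
  qed
  show "singleton_gamble X n ` D n \<subseteq> marg X N {n} (indep_nat_ext X N D)"
  proof
    fix f assume "f \<in> singleton_gamble X n ` D n"
    then obtain g where g: "g \<in> D n" and f: "f = singleton_gamble X n g" by blast
    have sec: "cyl_ext X N {n} f (w(n := a)) = g a" if "w \<in> \<Omega>" for w a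
      using cyl_ext_singleton_section[OF n that coherent_gambles[OF coherent_D[OF n] g]] f by simp
    then have "cyl_ext X N {n} f \<in> sectional n"
      using g cyl_ext_gambles by (simp add: sectional_def)
    then have "cyl_ext X N {n} f \<in> sum_cone N"
      using n by (rule sum_cone.sectional[rotated])
    moreover have "cyl_ext X N {n} f \<noteq> (\<lambda>_. 0)"
    proof
      assume "cyl_ext X N {n} f = (\<lambda>_. 0)"
      then have "g a = 0" for a using sec[OF z, of a] by simp
      then show False using coherent_nonzero[OF coherent_D[OF n] g] by auto
    qed
    ultimately show "f \<in> marg X N {n} (indep_nat_ext X N D)"
      by (simp add: marg_def indep_nat_ext_eq f gambles_def singleton_gamble_def)
  qed
qed

section \<open>Minimality\<close>

lemma indep_nat_ext_least:
  assumes "independent_product X N D E"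
  shows "indep_nat_ext X N D \<subseteq> E"
proof -
  have E: "coherent \<Omega> E"
    and indep: "\<And>I R xI. I \<subseteq> N \<Longrightarrow> R \<subseteq> N \<Longrightarrow> I \<inter> R = {} \<Longrightarrow> xI \<in> PiE I X \<Longrightarrow>
      marg X (N - I) R (cond X N I E xI) = marg X N R E"
    and marg: "\<And>n. n \<in> N \<Longrightarrow> marg X N {n} E = singleton_gamble X n ` D n"
    using assms by (auto simp: independent_product_def independent_def)
  have "irr_gamble n y g \<in> E" if n: "n \<in> N" and g: "g \<in> D n" and y: "y \<in> PiE (N - {n}) X" for n y g
  proof -
    \<comment> \<open>Conditioning on \<open>y\<close> leaves the marginal on \<open>n\<close>
      unchanged, so it still contains \<open>g\<close>; unfolding the conditioning puts the
      indicator of \<open>y\<close> times \<open>g\<close> in \<open>E\<close>.\<close>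
    have "singleton_gamble X n g \<in> marg X (N - (N - {n})) {n} (cond X N (N - {n}) E y)"
      using indep[OF _ _ _ y, of "{n}"] marg[OF n] n g by auto
    moreover have "N - (N - {n}) = {n}" using n by auto
    ultimately show ?thesis
      using n cyl_ext_cyl_ext[of "{n}" "{n}" "singleton_gamble X n g"]
      by (simp add: marg_def cond_def irr_gamble_def)
  qed
  then have "A_irr X N n (D n) \<subseteq> E" if "n \<in> N" for n
    unfolding A_irr_eq using that
    by (intro posi_least coherent_add[OF E] coherent_scale[OF E]) auto
  then show ?thesis
    unfolding indep_nat_ext_def
    by (intro posi_least coherent_add[OF E] coherent_scale[OF E]) (auto intro: coherent_pos[OF E])
qed

end

theorem theorem19:
  fixes N :: "'i set" and X :: "'i \<Rightarrow> 'a set" and D :: "'i \<Rightarrow> ('a \<Rightarrow> real) set"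
  assumes "finite N" and "N \<noteq> {}"
    and "\<And>n. n \<in> N \<Longrightarrow> finite (X n)" and "\<And>n. n \<in> N \<Longrightarrow> X n \<noteq> {}"
    and "\<And>n. n \<in> N \<Longrightarrow> coherent (X n) (D n)"
  shows "independent_product X N D (indep_nat_ext X N D) \<and>
    (\<forall>E. independent_product X N D E \<longrightarrow> indep_nat_ext X N D \<subseteq> E)"
proof -
  interpret coherent_models N X D
    using assms by unfold_locales
  show ?thesis
    using independent_indep_nat_ext marg_indep_nat_ext indep_nat_ext_least
    by (simp add: independent_product_def)
qed

end
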